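(* Let $\mathbf{H}_{11}\in\mathbb{C}^{N_1\times M_1}$ and $\mathbf{H}_{12}\in\mathbb{C}^{N_1\times M_2}$. Let $\mathbf{H}_{11}=\mathbf{U}_{H_{11}}\boldsymbol{\Lambda}_{H_{11}}\mathbf{V}_{H_{11}}^H$ be an ordered singular value decomposition, with $\mathbf{U}_{H_{11}}$ ($N_1\times N_1$) and $\mathbf{V}_{H_{11}}$ ($M_1\times M_1$) unitary and $\boldsymbol{\Lambda}_{H_{11}}$ the $N_1\times M_1$ matrix with main diagonal $(\lambda_{H_{11},1},\ldots,\lambda_{H_{11},\min(N_1,M_1)})$ and zeros off the diagonal, where $\lambda_{H_{11},1}^2\ge\lambda_{H_{11},2}^2\ge\cdots\ge\lambda_{H_{11},\min(N_1,M_1)}^2$. Let $\mathbf{P}_1=\mathrm{diag}(p_{1,1},\ldots,p_{1,M_1})$ be the primary water-filling power allocation and $m_1$ the number of indices $n$ with $p_{1,n}>0$ (see context). Set $\tilde{\mathbf{H}}=\mathbf{U}_{H_{11}}^H\mathbf{H}_{12}$ and write it in block form $$\tilde{\mathbf{H}}=\begin{pmatrix}\tilde{\mathbf{H}}_1\\ \tilde{\mathbf{H}}_2\end{pmatrix},$$ with $\tilde{\mathbf{H}}_1$ of size $m_1\times M_2$ and $\tilde{\mathbf{H}}_2$ of size $(N_1-m_1)\times M_2$. Let $L_2$ be the dimension of the null space of $\tilde{\mathbf{H}}_1$. If the $M_2\times L_2$ pre-processing matrix $\mathbf{V}_2$ satisfies $$\tilde{\mathbf{H}}_1\mathbf{V}_2=\mathbf{0}_{m_1\times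 L_2},$$ then the interference alignment (IA) condition is satisfied independently of the power allocation matrix $\mathbf{P}_2$; that is, for every $L_2\times L_2$ power allocation matrix $\mathbf{P}_2$, $$\log_2\left|\mathbf{I}_{N_1}+\tfrac{1}{\sigma_1^2}\boldsymbol{\Lambda}_{H_{11}}\mathbf{P}_1\boldsymbol{\Lambda}_{H_{11}}^H\right|=\log_2\left|\mathbf{I}_{N_1}+\mathbf{R}^{-1}\boldsymbol{\Lambda}_{H_{11}}\mathbf{P}_1\boldsymbol{\Lambda}_{H_{11}}^H\right|,$$ where $$\mathbf{R}=\sigma_1^2\mathbf{I}_{N_1}+\mathbf{U}_{H_{11}}^H\mathbf{H}_{12}\mathbf{V}_2\mathbf{P}_2\mathbf{V}_2^H\mathbf{H}_{12}^H\mathbf{U}_{H_{11}}.$$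
   Context: $|\cdot|$ denotes the determinant, $(\cdot)^H$ the conjugate transpose, $(x)^+=\max(0,x)$. $\sigma_1^2>0$ is the primary noise variance and $p_{1,\max}>0$ the primary power budget. Primary water-filling: $\boldsymbol{\Lambda}_{H_{11}}^H\boldsymbol{\Lambda}_{H_{11}}=\mathrm{diag}(\lambda_{H_{11}^HH_{11},1},\ldots,\lambda_{H_{11}^HH_{11},M_1})$ and, for $n=1,\ldots,M_1$, $p_{1,n}=\left(\beta-\frac{\sigma_1^2}{\lambda_{H_{11}^HH_{11},n}}\right)^+$, with $p_{1,n}=0$ when $\lambda_{H_{11}^HH_{11},n}=0$; the constant $\beta$ (water-level) is set so that $\sum_{n=1}^{M_1}p_{1,n}=M_1p_{1,\max}$ ($\mathbf{H}_{11}$ is assumed nonzero so that $\beta$ exists). Because the singular values are ordered, the $m_1$ indices with $p_{1,n}>0$ are $1,\ldots,m_1$. A power allocation matrix $\mathbf{P}_2$ is the (diagonal, with nonnegative entries) covariance matrix of the secondary symbols. $\mathbf{R}$ is the covariance matrix of the interference plus noise in the primary link after post-processing by $\mathbf{U}_{H_{11}}^H$. The IA condition is by definition the displayed equality of the two log-determinants. *)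

theory Defs
  imports
    "Jordan_Normal_Form.Schur_Decomposition"
    "Jordan_Normal_Form.Matrix_Kernel"
    "Jordan_Normal_Form.Gauss_Jordan_Elimination"
begin

definition unitary_mat :: "nat \<Rightarrow> complex mat \<Rightarrow> bool" where
  "unitary_mat n U \<longleftrightarrow> U \<in> carrier_mat n n \<and>
     U * mat_adjoint U = 1\<^sub>m n \<and> mat_adjoint U * U = 1\<^sub>m n"

definition rect_diag :: "nat \<Rightarrow> nat \<Rightarrow> (nat \<Rightarrow> complex) \<Rightarrow> complex mat" where
  "rect_diag nr nc d = mat nr nc (\<lambda>(i, j). if i = j then d i else 0)"

(* Indices start at 0; only the values s 0, ..., s (min nr nc - 1) matter. *)
definition ordered_svd ::
  "nat \<Rightarrow> nat \<Rightarrow> complex mat \<Rightarrow> complex mat \<Rightarrow> complex mat \<Rightarrow> (nat \<Rightarrow> real) \<Rightarrow> complex mat \<Rightarrow> bool" where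
  "ordered_svd nr nc H U \<Lambda> s V \<longleftrightarrow>
     unitary_mat nr U \<and> unitary_mat nc V \<and>
     \<Lambda> = rect_diag nr nc (\<lambda>i. complex_of_real (s i)) \<and>
     H = U * \<Lambda> * mat_adjoint V \<and>
     (\<forall>i < min nr nc. 0 \<le> s i) \<and>
     (\<forall>i j. i \<le> j \<longrightarrow> j < min nr nc \<longrightarrow> (s j)\<^sup>2 \<le> (s i)\<^sup>2)"

(* The case g = 0 is needed separately, since division by zero yields zero. *)
definition water_fill :: "real \<Rightarrow> real \<Rightarrow> real \<Rightarrow> real" where
  "water_fill \<beta> v g = (if g = 0 then 0 else max 0 (\<beta> - v / g))"

definition power_allocation :: "nat \<Rightarrow> complex mat \<Rightarrow> bool" where
  "power_allocation n P \<longleftrightarrow> P \<in> carrier_mat n n \<and> diagonal_mat P \<and>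
     (\<forall>i < n. P $$ (i, i) \<in> \<real> \<and> 0 \<le> Re (P $$ (i, i)))"

(* Meaningful only if A is invertible: otherwise mat_inverse A = None
   and the value is unspecified. *)
definition mat_inv :: "complex mat \<Rightarrow> complex mat" where
  "mat_inv A = the (mat_inverse A)"

(* The determinant has type complex; its binary logarithm is the real one
   only if this predicate holds. *)
definition pos_det :: "complex mat \<Rightarrow> bool" where
  "pos_det A \<longleftrightarrow> det A \<in> \<real> \<and> 0 < Re (det A)"

definition log2_det :: "complex mat \<Rightarrow> real" where
  "log2_det A = log 2 (Re (det A))"

end

theory Submission
  imports Defs
begin

text \<open>Water-filling is monotone in the channel gain, so the active primary channels are the first
  \<open>m1\<close> ones and \<open>D = \<Lambda>11 P1 \<Lambda>11\<^sup>H\<close> is diagonal with zero entries from index \<open>m1\<close> on. The hypothesis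
  on \<open>V2\<close> makes the first \<open>m1\<close> rows and columns of the interference covariance vanish, hence
  \<open>R D = \<sigma>1\<^sup>2 D\<close> and the two matrices whose determinants are compared are equal. Invertibility of
  \<open>R\<close> holds because it is a positive multiple of the identity plus a positive semidefinite matrix.\<close>

section \<open>Conjugate transposes and Hermitian quadratic forms\<close>

lemma mat_adjoint_dim [simp]:
  "dim_row (mat_adjoint A) = dim_col A" "dim_col (mat_adjoint A) = dim_row A"
  by (auto simp: mat_adjoint_def mat_of_rows_def)

lemma mat_adjoint_carrier:
  assumes "A \<in> carrier_mat n m"
  shows "mat_adjoint A \<in> carrier_mat m n"
  using assms by auto

lemma mat_adjoint_index:
  fixes A :: "complex mat"
  assumes "A \<in> carrier_mat n m" and "i < m" and "j < n"
  shows "mat_adjoint A $$ (i, j) = cnj (A $$ (j, i))"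
  using assms by (simp add: mat_adjoint_def mat_of_rows_def)

lemma mult_mat_index_sum:
  assumes "A \<in> carrier_mat n m" and "B \<in> carrier_mat m l" and "i < n" and "j < l"
  shows "(A * B) $$ (i, j) = (\<Sum>k<m. A $$ (i, k) * B $$ (k, j))"
  using assms by (auto simp: scalar_prod_def atLeast0LessThan)

lemma mat_adjoint_mult:
  fixes A B :: "complex mat"
  assumes A: "A \<in> carrier_mat n m" and B: "B \<in> carrier_mat m l"
  shows "mat_adjoint (A * B) = mat_adjoint B * mat_adjoint A"
proof (rule eq_matI)
  have AB: "A * B \<in> carrier_mat n l" using A B by simp
  note cA = mat_adjoint_carrier[OF A] and cB = mat_adjoint_carrier[OF B]
  show "dim_row (mat_adjoint (A * B)) = dim_row (mat_adjoint B * mat_adjoint A)"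
    and "dim_col (mat_adjoint (A * B)) = dim_col (mat_adjoint B * mat_adjoint A)"
    using mat_adjoint_carrier[OF AB] cA cB by auto
  fix i j
  assume "i < dim_row (mat_adjoint B * mat_adjoint A)" "j < dim_col (mat_adjoint B * mat_adjoint A)"
  then have i: "i < l" and j: "j < n" using cA cB by auto
  show "mat_adjoint (A * B) $$ (i, j) = (mat_adjoint B * mat_adjoint A) $$ (i, j)"
    unfolding mat_adjoint_index[OF AB i j] mult_mat_index_sum[OF A B j i] mult_mat_index_sum[OF cB cA i j]
    by (simp add: mat_adjoint_index[OF A _ j] mat_adjoint_index[OF B i] mult.commute)
qed

lemma mat_adjoint_adjoint:
  fixes A :: "complex mat"
  shows "mat_adjoint (mat_adjoint A) = A"
proof -
  have A: "A \<in> carrier_mat (dim_row A) (dim_col A)" by simp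
  note cA = mat_adjoint_carrier[OF A]
  show ?thesis
    using mat_adjoint_carrier[OF cA]
    by (intro eq_matI) (auto simp: mat_adjoint_index[OF cA] mat_adjoint_index[OF A])
qed

text \<open>For a kernel vector \<open>v\<close> of the matrix, the quadratic form at
  \<open>v\<close> is 0. It also equals \<open>c\<close> times the squared norm of \<open>v\<close>
  plus the weighted sum of the squared moduli of the entries of the adjoint of \<open>K\<close>
  applied to \<open>v\<close>. Both parts are nonnegative, so \<open>v\<close> vanishes.\<close>

lemma scaled_one_plus_psd_det_nonzero:
  fixes K P :: "complex mat" and c :: real
  assumes c: "c > 0" and K: "K \<in> carrier_mat n l" and P: "power_allocation l P"
  shows "det (complex_of_real c \<cdot>\<^sub>m 1\<^sub>m n + K * P * mat_adjoint K) \<noteq> 0"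
proof
  let ?R = "complex_of_real c \<cdot>\<^sub>m 1\<^sub>m n + K * P * mat_adjoint K"
  assume "det ?R = 0"
  have Pc: "P \<in> carrier_mat l l" using P by (simp add: power_allocation_def)
  note Kc = mat_adjoint_carrier[OF K]
  have Rc: "?R \<in> carrier_mat n n" using K by auto
  obtain v where v: "v \<in> carrier_vec n" "v \<noteq> 0\<^sub>v n" "?R *\<^sub>v v = 0\<^sub>v n"
    using \<open>det ?R = 0\<close> det_0_iff_vec_prod_zero_field[OF Rc] by blast
  \<comment> \<open>The diagonal entries of \<open>P\<close> are real, so taking real parts loses
    nothing; \<open>w\<close> is the adjoint of \<open>K\<close> applied to
    \<open>v\<close>.\<close>
  define p where "p k = Re (P $$ (k, k))" for k
  define w where "w k = (\<Sum>j<n. cnj (K $$ (j, k)) * v $ j)" for k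
  have p: "P $$ (k, k) = complex_of_real (p k)" "0 \<le> p k" if "k < l" for k
    using P that by (auto simp: power_allocation_def p_def complex_eq_iff complex_is_Real_iff)
  have Poff: "P $$ (i, k) = 0" if "i < l" "k < l" "i \<noteq> k" for i k
    using P that by (auto simp: power_allocation_def diagonal_mat_def)
  have KP: "(K * P) $$ (i, k) = K $$ (i, k) * complex_of_real (p k)" if "i < n" "k < l" for i k
  proof -
    have "(K * P) $$ (i, k) = (\<Sum>t<l. if t = k then K $$ (i, k) * complex_of_real (p k) else 0)"
      unfolding mult_mat_index_sum[OF K Pc that]
      by (rule sum.cong) (auto simp: Poff that p)
    then show ?thesis using that by simp
  qed
  have R: "?R $$ (i, j) = (if i = j then complex_of_real c else 0)
      + (\<Sum>k<l. K $$ (i, k) * complex_of_real (p k) * cnj (K $$ (j, k)))" if "i < n" "j < n" for i j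
  proof -
    have "(K * P * mat_adjoint K) $$ (i, j)
        = (\<Sum>k<l. K $$ (i, k) * complex_of_real (p k) * cnj (K $$ (j, k)))"
      using mult_mat_index_sum[OF mult_carrier_mat[OF K Pc] Kc that]
      by (simp add: KP that mat_adjoint_index[OF K])
    moreover have "?R $$ (i, j) = (complex_of_real c \<cdot>\<^sub>m 1\<^sub>m n) $$ (i, j) + (K * P * mat_adjoint K) $$ (i, j)"
      using K Pc Kc that by (intro index_add_mat) auto
    ultimately show ?thesis using that by simp
  qed
  have row: "complex_of_real c * v $ i + (\<Sum>k<l. K $$ (i, k) * complex_of_real (p k) * w k) = 0"
    if i: "i < n" for i
  proof -
    have "0 = (?R *\<^sub>v v) $ i" using v i by simp
    also have "\<dots> = (\<Sum>j<n. ?R $$ (i, j) * v $ j)"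
      using Rc v(1) i by (auto simp: scalar_prod_def atLeast0LessThan simp del: index_add_mat)
    also have "\<dots> = (\<Sum>j<n. (if i = j then complex_of_real c * v $ j else 0)
        + (\<Sum>k<l. K $$ (i, k) * complex_of_real (p k) * (cnj (K $$ (j, k)) * v $ j)))"
      by (rule sum.cong) (auto simp: R i algebra_simps sum_distrib_left)
    also have "\<dots> = complex_of_real c * v $ i
        + (\<Sum>j<n. \<Sum>k<l. K $$ (i, k) * complex_of_real (p k) * (cnj (K $$ (j, k)) * v $ j))"
      using i by (simp add: sum.distrib)
    also have "(\<Sum>j<n. \<Sum>k<l. K $$ (i, k) * complex_of_real (p k) * (cnj (K $$ (j, k)) * v $ j))
        = (\<Sum>k<l. K $$ (i, k) * complex_of_real (p k) * w k)"
      by (subst sum.swap) (simp add: w_def sum_distrib_left)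
    finally show ?thesis by simp
  qed
  \<comment> \<open>Weighting equation \<open>i\<close> by the conjugate of \<open>v $ i\<close> and
    summing produces the quadratic form.\<close>
  have "0 = (\<Sum>i<n. cnj (v $ i) * (complex_of_real c * v $ i
      + (\<Sum>k<l. K $$ (i, k) * complex_of_real (p k) * w k)))"
    by (simp add: row)
  also have "\<dots> = (\<Sum>i<n. complex_of_real (c * (cmod (v $ i))\<^sup>2))
      + (\<Sum>i<n. \<Sum>k<l. complex_of_real (p k) * w k * (cnj (v $ i) * K $$ (i, k)))"
    by (simp add: distrib_left sum.distrib sum_distrib_left mult_ac complex_norm_square del: of_real_power)
  \<comment> \<open>After the exchange of sums, the inner sum over \<open>i\<close> is the conjugate
    of \<open>w k\<close>, which pairs with \<open>w k\<close> to a squared modulus.\<close>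
  also have "(\<Sum>i<n. \<Sum>k<l. complex_of_real (p k) * w k * (cnj (v $ i) * K $$ (i, k)))
      = (\<Sum>k<l. complex_of_real (p k * (cmod (w k))\<^sup>2))"
  proof (subst sum.swap, rule sum.cong)
    fix k
    have "cnj (w k) = (\<Sum>i<n. cnj (v $ i) * K $$ (i, k))" by (simp add: w_def mult.commute)
    then show "(\<Sum>i<n. complex_of_real (p k) * w k * (cnj (v $ i) * K $$ (i, k)))
        = complex_of_real (p k * (cmod (w k))\<^sup>2)"
      by (simp add: sum_distrib_left[symmetric] complex_norm_square del: of_real_power)
  qed simp
  finally have "complex_of_real ((\<Sum>i<n. c * (cmod (v $ i))\<^sup>2) + (\<Sum>k<l. p k * (cmod (w k))\<^sup>2)) = 0"
    by simp
  then have "(\<Sum>i<n. c * (cmod (v $ i))\<^sup>2) + (\<Sum>k<l. p k * (cmod (w k))\<^sup>2) = 0"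
    unfolding of_real_eq_0_iff .
  moreover have "(\<Sum>k<l. p k * (cmod (w k))\<^sup>2) \<ge> 0" by (intro sum_nonneg) (simp add: p)
  moreover have "(\<Sum>i<n. c * (cmod (v $ i))\<^sup>2) \<ge> 0" using c by (intro sum_nonneg) simp
  ultimately have "(\<Sum>i<n. c * (cmod (v $ i))\<^sup>2) = 0" by linarith
  then have "\<forall>i<n. v $ i = 0" using c by (subst (asm) sum_nonneg_eq_0_iff) auto
  then have "v = 0\<^sub>v n" using v(1) by (intro eq_vecI) auto
  with v(2) show False by simp
qed

section \<open>Inverses, positive determinants and monotonicity of water-filling\<close>

lemma det_nonzero_mat_inv:
  assumes A: "A \<in> carrier_mat n n" and "det A \<noteq> 0"
  shows "mat_inv A \<in> carrier_mat n n" and "A * mat_inv A = 1\<^sub>m n" and "mat_inv A * A = 1\<^sub>m n"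
proof -
  \<comment> \<open>This makes \<open>the\<close> in \<open>mat_inv\<close> return a genuine
    inverse. The argument \<open>()\<close> fills the record extension of the matrix ring, so that
    both facts speak of units of the same ring.\<close>
  have "mat_inverse A \<noteq> None"
    using det_non_zero_imp_unit[OF assms, of "()"] mat_inverse(1)[OF A, of "()"] by blast
  then have "mat_inverse A = Some (mat_inv A)" by (auto simp: mat_inv_def)
  from mat_inverse(2)[OF A this]
  show "mat_inv A \<in> carrier_mat n n" and "A * mat_inv A = 1\<^sub>m n" and "mat_inv A * A = 1\<^sub>m n"
    by auto
qed

lemma det_mat_diag: "det (mat_diag n f) = (\<Prod>i<n. f i)"
proof -
  have "det (mat_diag n f) = prod_list (diag_mat (mat_diag n f))"
    by (rule det_upper_triangular[OF _ mat_diag_dim]) (auto simp: upper_triangular_def mat_diag_def)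
  also have "diag_mat (mat_diag n f) = map f [0..<n]"
    by (auto simp: diag_mat_def mat_diag_def)
  finally show ?thesis by (simp add: prod.list_conv_set_nth atLeast0LessThan)
qed

lemma pos_det_mat_diag:
  assumes "\<And>i. i < n \<Longrightarrow> d i > 0"
  shows "pos_det (mat_diag n (\<lambda>i. complex_of_real (d i)))"
proof -
  have "det (mat_diag n (\<lambda>i. complex_of_real (d i))) = complex_of_real (\<Prod>i<n. d i)"
    by (simp add: det_mat_diag)
  moreover have "(\<Prod>i<n. d i) > 0" using assms by (intro prod_pos) simp
  \<comment> \<open>The product stays under a single \<open>complex_of_real\<close>, from which
    realness and the real part can be read off.\<close>
  ultimately show ?thesis unfolding pos_det_def by (simp del: of_real_prod)
qed

text \<open>A positive allocation excludes the separate case \<open>g = 0\<close>; for positive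
  gains \<open>v / g\<close> decreases as the gain grows, so a stronger channel lies deeper below
  the water level.\<close>

lemma water_fill_mono:
  assumes "v > 0" and "0 \<le> g" and "g \<le> h" and "water_fill \<beta> v g > 0"
  shows "water_fill \<beta> v h > 0"
proof -
  have "g > 0" and "\<beta> - v / g > 0"
    using assms by (auto simp: water_fill_def split: if_splits)
  moreover have "v / h \<le> v / g" using assms \<open>g > 0\<close> by (intro divide_left_mono) auto
  ultimately show ?thesis using assms(3) by (auto simp: water_fill_def)
qed

section \<open>Rectangular diagonal matrices and stacked rows\<close>

lemma rect_diag_index:
  "rect_diag nr nc d \<in> carrier_mat nr nc"
  "i < nr \<Longrightarrow> j < nc \<Longrightarrow> rect_diag nr nc d $$ (i, j) = (if i = j then d i else 0)"
  by (auto simp: rect_diag_def)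

lemma adjoint_rect_diag:
  "mat_adjoint (rect_diag nr nc (\<lambda>i. complex_of_real (s i)))
    = rect_diag nc nr (\<lambda>i. complex_of_real (s i))"
  using mat_adjoint_carrier[OF rect_diag_index(1)[of nr nc "\<lambda>i. complex_of_real (s i)"]]
    rect_diag_index(1)[of nc nr "\<lambda>i. complex_of_real (s i)"]
  by (intro eq_matI) (auto simp: mat_adjoint_index[OF rect_diag_index(1)] rect_diag_index(2))

text \<open>Only the inner index \<open>k = i\<close> can contribute to row \<open>i\<close>. If
  \<open>nr > nc\<close>, it is out of range for the rows from \<open>nc\<close> on, whence the
  guard \<open>i < nc\<close>.\<close>

lemma rect_diag_mult:
  fixes d e :: "nat \<Rightarrow> complex"
  shows "rect_diag nr nc d * rect_diag nc nr e = mat_diag nr (\<lambda>i. if i < nc then d i * e i else 0)"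
proof (rule eq_matI)
  fix i j
  assume "i < dim_row (mat_diag nr (\<lambda>i. if i < nc then d i * e i else 0))"
    and "j < dim_col (mat_diag nr (\<lambda>i. if i < nc then d i * e i else 0))"
  then have i: "i < nr" and j: "j < nr" by (auto simp: mat_diag_def)
  have "(rect_diag nr nc d * rect_diag nc nr e) $$ (i, j)
      = (\<Sum>k<nc. if k = i then (if i = j then d i * e i else 0) else 0)"
    unfolding mult_mat_index_sum[OF rect_diag_index(1) rect_diag_index(1) i j]
    by (rule sum.cong) (auto simp: rect_diag_index(2) i j)
  then show "(rect_diag nr nc d * rect_diag nc nr e) $$ (i, j)
      = mat_diag nr (\<lambda>i. if i < nc then d i * e i else 0) $$ (i, j)"
    using i j by (simp add: mat_diag_def)
qed (auto simp: rect_diag_def mat_diag_def)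

lemma rect_diag_mat_diag:
  "rect_diag nr nc d * mat_diag nc f = rect_diag nr nc (\<lambda>i. d i * f i)"
  by (subst mat_diag_mult_right[OF rect_diag_index(1)]) (auto simp: rect_diag_def)

lemma mat_diag_cong:
  "(\<And>i. i < n \<Longrightarrow> f i = h i) \<Longrightarrow> mat_diag n f = mat_diag n h"
  by (auto simp: mat_diag_def)

lemma append_rows_mult_zero:
  fixes A B V :: "'a :: semiring_0 mat"
  assumes A: "A \<in> carrier_mat m n" and B: "B \<in> carrier_mat k n" and V: "V \<in> carrier_mat n l"
    and z: "A * V = 0\<^sub>m m l" and "i < m" and "j < l"
  shows "((A @\<^sub>r B) * V) $$ (i, j) = 0"
proof -
  have "((A @\<^sub>r B) * V) $$ (i, j) = (A * V) $$ (i, j)"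
    unfolding mult_mat_index_sum[OF carrier_append_rows[OF A B] V trans_less_add1[OF \<open>i < m\<close>] \<open>j < l\<close>]
      mult_mat_index_sum[OF A V \<open>i < m\<close> \<open>j < l\<close>]
    using assms by (intro sum.cong) (auto simp: append_rows_def)
  then show ?thesis using z assms by simp
qed

section \<open>Cancellation of the interference on the active primary channels\<close>

theorem lemma1:
  fixes N1 M1 M2 m1 L2 :: nat
    and H11 H12 U11 \<Lambda>11 V11 P1 Ht Ht1 Ht2 V2 :: "complex mat"
    and s g p1 :: "nat \<Rightarrow> real"
    and \<sigma>1 p1max \<beta> :: real
  assumes "\<sigma>1\<^sup>2 > 0" and "p1max > 0"
    and "H11 \<in> carrier_mat N1 M1" and "H11 \<noteq> 0\<^sub>m N1 M1"
    and "H12 \<in> carrier_mat N1 M2"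
    and "ordered_svd N1 M1 H11 U11 \<Lambda>11 s V11"
    and "mat_adjoint \<Lambda>11 * \<Lambda>11 = mat_diag M1 (\<lambda>n. complex_of_real (g n))"
    and "\<And>n. n < M1 \<Longrightarrow> p1 n = water_fill \<beta> (\<sigma>1\<^sup>2) (g n)"
    and "(\<Sum>n<M1. p1 n) = real M1 * p1max"
    and "P1 = mat_diag M1 (\<lambda>n. complex_of_real (p1 n))"
    and "m1 = card {n. n < M1 \<and> p1 n > 0}"
    and "Ht = mat_adjoint U11 * H12"
    and "Ht = Ht1 @\<^sub>r Ht2"
    and "Ht1 \<in> carrier_mat m1 M2" and "Ht2 \<in> carrier_mat (N1 - m1) M2"
    and "L2 = kernel_dim Ht1"
    and "V2 \<in> carrier_mat M2 L2"
    and "Ht1 * V2 = 0\<^sub>m m1 L2"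
  shows "\<forall>P2. power_allocation L2 P2 \<longrightarrow>
    (let R = complex_of_real (\<sigma>1\<^sup>2) \<cdot>\<^sub>m 1\<^sub>m N1
           + mat_adjoint U11 * H12 * V2 * P2 * mat_adjoint V2 * mat_adjoint H12 * U11;
         A = 1\<^sub>m N1 + complex_of_real (1 / \<sigma>1\<^sup>2) \<cdot>\<^sub>m (\<Lambda>11 * P1 * mat_adjoint \<Lambda>11);
         B = 1\<^sub>m N1 + mat_inv R * \<Lambda>11 * P1 * mat_adjoint \<Lambda>11
     in invertible_mat R \<and> pos_det A \<and> pos_det B \<and> log2_det A = log2_det B)"
proof (intro allI impI)
  fix P2
  assume P2: "power_allocation L2 P2"
  define v where "v = \<sigma>1\<^sup>2"
  define r where "r = min N1 M1"
  \<comment> \<open>These will be the diagonal entries of \<open>D\<close>. The guard is essential: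
    beyond \<open>r\<close> the values of \<open>s\<close> are unconstrained.\<close>
  define q where "q i = (if i < r then (s i)\<^sup>2 * p1 i else 0)" for i
  \<comment> \<open>\<open>K\<close> is the channel from secondary symbols to primary receiver after
    pre- and post-processing; the interference covariance is
    \<open>K * P2 * mat_adjoint K\<close>.\<close>
  define K where "K = Ht * V2"
  define R where "R = complex_of_real v \<cdot>\<^sub>m 1\<^sub>m N1
    + mat_adjoint U11 * H12 * V2 * P2 * mat_adjoint V2 * mat_adjoint H12 * U11"
  define D where "D = \<Lambda>11 * P1 * mat_adjoint \<Lambda>11"
  have v: "v > 0" using assms(1) by (simp add: v_def)
  have U: "U11 \<in> carrier_mat N1 N1" and L: "\<Lambda>11 = rect_diag N1 M1 (\<lambda>i. complex_of_real (s i))"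
    and ord: "\<And>i j. i \<le> j \<Longrightarrow> j < r \<Longrightarrow> (s j)\<^sup>2 \<le> (s i)\<^sup>2"
    using assms(6) by (auto simp: ordered_svd_def unitary_mat_def r_def)
  have P2c: "P2 \<in> carrier_mat L2 L2" using P2 by (simp add: power_allocation_def)
  have Htc: "Ht \<in> carrier_mat N1 M2" using assms(5,12) mat_adjoint_carrier[OF U] by simp
  have Kc: "K \<in> carrier_mat N1 L2" using Htc assms(17) by (simp add: K_def)

  \<comment> \<open>Comparing diagonal entries of the Gram matrix identifies the gains; for
    \<open>M1 > N1\<close> the surplus columns have gain 0.\<close>
  have g: "g n = (if n < r then (s n)\<^sup>2 else 0)" if "n < M1" for n
  proof -
    have "mat_diag M1 (\<lambda>n. complex_of_real (g n)) $$ (n, n)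
        = mat_diag M1 (\<lambda>i. if i < N1 then complex_of_real (s i) * complex_of_real (s i) else 0) $$ (n, n)"
      using assms(7) by (simp add: L adjoint_rect_diag rect_diag_mult)
    then have "complex_of_real (g n) = complex_of_real (if n < r then (s n)\<^sup>2 else 0)"
      using that by (auto simp: mat_diag_def r_def power2_eq_square split: if_splits)
    then show ?thesis by (simp only: of_real_eq_iff)
  qed
  have p_nonneg: "p1 n \<ge> 0" if "n < M1" for n
    using assms(8)[OF that] by (simp add: water_fill_def)
  have p_zero: "p1 i = 0" if i: "i < r" "m1 \<le> i" for i
  proof (rule ccontr)
    assume "p1 i \<noteq> 0"
    then have "water_fill \<beta> v (g i) > 0"
      using p_nonneg[of i] assms(8)[of i] i by (auto simp: r_def v_def)
    \<comment> \<open>The ordering of the singular values gives \<open>g i \<le> g j\<close>, so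
      activity of channel \<open>i\<close> passes down to channel \<open>j\<close>.\<close>
    then have "p1 j > 0" if "j \<le> i" for j
      using water_fill_mono[OF v, of "g i" "g j" \<beta>] g[of i] g[of j] ord[OF that] that i assms(8)[of j]
      by (auto simp: r_def v_def)
    \<comment> \<open>The set \<open>{..i}\<close> has \<open>i + 1\<close> elements, but there are
      only \<open>m1 \<le> i\<close> active indices.\<close>
    then have "{..i} \<subseteq> {n. n < M1 \<and> p1 n > 0}" using i by (auto simp: r_def)
    then have "card {..i} \<le> m1" unfolding assms(11) by (intro card_mono) auto
    with i show False by simp
  qed
  have q: "q i \<ge> 0" "m1 \<le> i \<Longrightarrow> q i = 0" for i
    using p_nonneg[of i] p_zero[of i] by (auto simp: q_def r_def)
  have D: "D = mat_diag N1 (\<lambda>i. complex_of_real (q i))"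
    unfolding D_def L assms(10) adjoint_rect_diag rect_diag_mat_diag rect_diag_mult
    by (rule mat_diag_cong) (auto simp: q_def r_def power2_eq_square)
  then have Dc: "D \<in> carrier_mat N1 N1" by simp

  have adjK: "mat_adjoint K = mat_adjoint V2 * mat_adjoint H12 * U11"
    using mat_adjoint_mult[OF Htc assms(17)] mat_adjoint_mult[OF mat_adjoint_carrier[OF U] assms(5)]
      assoc_mult_mat[OF mat_adjoint_carrier[OF assms(17)] mat_adjoint_carrier[OF assms(5)] U]
    by (simp add: K_def assms(12) mat_adjoint_adjoint)
  \<comment> \<open>In this form \<open>R\<close> is visibly a positive multiple of the identity
    plus a positive semidefinite matrix, and zero rows of \<open>K\<close> become zero columns of
    the interference term.\<close>
  have R_K: "R = complex_of_real v \<cdot>\<^sub>m 1\<^sub>m N1 + K * P2 * mat_adjoint K"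
  proof -
    have KP: "K * P2 \<in> carrier_mat N1 L2" using Kc P2c by simp
    note aV = mat_adjoint_carrier[OF assms(17)] and aH = mat_adjoint_carrier[OF assms(5)]
    have "K * P2 * mat_adjoint K = K * P2 * mat_adjoint V2 * mat_adjoint H12 * U11"
      unfolding adjK
        assoc_mult_mat[OF KP mult_carrier_mat[OF aV aH] U, symmetric]
        assoc_mult_mat[OF KP aV aH, symmetric] ..
    then show ?thesis by (simp add: R_def K_def assms(12))
  qed
  have Rc: "R \<in> carrier_mat N1 N1"
    using Kc by (auto simp: R_K)
  have detR: "det R \<noteq> 0"
    unfolding R_K by (rule scaled_one_plus_psd_det_nonzero[OF v Kc P2])
  note inv = det_nonzero_mat_inv[OF Rc detR]

  have K_zero: "K $$ (j, k) = 0" if "j < m1" "k < L2" for j k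
    unfolding K_def assms(13) by (rule append_rows_mult_zero[OF assms(14,15,17,18) that])
  \<comment> \<open>Every summand of the interference entry \<open>(i, j)\<close> contains the
    conjugate of some \<open>K $$ (j, k)\<close>, which is 0 for \<open>j < m1\<close>.\<close>
  have R_col: "R $$ (i, j) = (if i = j then complex_of_real v else 0)"
    if "i < N1" "j < N1" "j < m1" for i j
  proof -
    have "(K * P2 * mat_adjoint K) $$ (i, j) = 0"
      using mult_mat_index_sum[OF mult_carrier_mat[OF Kc P2c] mat_adjoint_carrier[OF Kc] that(1,2)]
      by (simp add: mat_adjoint_index[OF Kc _ that(2)] K_zero that)
    moreover have "R $$ (i, j) = (complex_of_real v \<cdot>\<^sub>m 1\<^sub>m N1) $$ (i, j) + (K * P2 * mat_adjoint K) $$ (i, j)"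
      unfolding R_K using that Kc P2c mat_adjoint_carrier[OF Kc] by (intro index_add_mat) auto
    ultimately show ?thesis using that by simp
  qed
  have RD: "R * D = complex_of_real v \<cdot>\<^sub>m D"
  proof -
    \<comment> \<open>Right multiplication by \<open>D\<close> scales column \<open>j\<close> of
      \<open>R\<close> by \<open>q j\<close>: for \<open>j < m1\<close> that column is
      interference-free, and for the others \<open>q j = 0\<close>.\<close>
    have "R $$ (i, j) * complex_of_real (q j) = (complex_of_real v \<cdot>\<^sub>m D) $$ (i, j)"
      if "i < N1" "j < N1" for i j
      using that R_col[of i j] q(2)[of j] by (cases "j < m1") (auto simp: D mat_diag_def)
    then show ?thesis
      unfolding mat_diag_mult_right[OF Rc, of "\<lambda>i. complex_of_real (q i)", folded D]
      using Dc by (intro eq_matI) auto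
  qed
  have invD: "mat_inv R * D = complex_of_real (1 / v) \<cdot>\<^sub>m D"
  proof -
    \<comment> \<open>Cancelling \<open>R\<close> this way avoids computing its inverse: only the
      action of the inverse on \<open>D\<close> is needed.\<close>
    have "D = mat_inv R * (R * D)"
      using inv(3) assoc_mult_mat[OF inv(1) Rc Dc] Dc by simp
    also have "\<dots> = complex_of_real v \<cdot>\<^sub>m (mat_inv R * D)"
      unfolding RD by (rule mult_smult_distrib[OF inv(1) Dc])
    finally have "complex_of_real (1 / v) \<cdot>\<^sub>m D
        = complex_of_real (1 / v) \<cdot>\<^sub>m (complex_of_real v \<cdot>\<^sub>m (mat_inv R * D))"
      by simp
    also have "\<dots> = mat_inv R * D"
      using v by (intro eq_matI) auto
    finally show ?thesis by simp
  qed
  have B: "mat_inv R * \<Lambda>11 * P1 * mat_adjoint \<Lambda>11 = mat_inv R * D"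
  proof -
    have Lc: "\<Lambda>11 \<in> carrier_mat N1 M1" by (simp add: L rect_diag_index(1))
    have Pc: "P1 \<in> carrier_mat M1 M1" by (simp add: assms(10))
    show ?thesis
      unfolding D_def assoc_mult_mat[OF inv(1) Lc Pc]
      by (rule assoc_mult_mat[OF inv(1) mult_carrier_mat[OF Lc Pc] mat_adjoint_carrier[OF Lc]])
  qed
  \<comment> \<open>The diagonal entries are at least 1, so the determinant is a positive real and
    its logarithm is the intended one.\<close>
  have A: "1\<^sub>m N1 + complex_of_real (1 / v) \<cdot>\<^sub>m D = mat_diag N1 (\<lambda>i. complex_of_real (1 + q i / v))"
    by (intro eq_matI) (auto simp: D mat_diag_def)
  have pos: "pos_det (1\<^sub>m N1 + complex_of_real (1 / v) \<cdot>\<^sub>m D)"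
    unfolding A
  proof (rule pos_det_mat_diag)
    show "1 + q i / v > 0" for i using q(1)[of i] v by (simp add: add_pos_nonneg)
  qed
  have invR: "invertible_mat R"
    unfolding invertible_mat_def inverts_mat_def
    using inv Rc by (intro conjI exI[of _ "mat_inv R"]) auto
  show "let R = complex_of_real (\<sigma>1\<^sup>2) \<cdot>\<^sub>m 1\<^sub>m N1
           + mat_adjoint U11 * H12 * V2 * P2 * mat_adjoint V2 * mat_adjoint H12 * U11;
         A = 1\<^sub>m N1 + complex_of_real (1 / \<sigma>1\<^sup>2) \<cdot>\<^sub>m (\<Lambda>11 * P1 * mat_adjoint \<Lambda>11);
         B = 1\<^sub>m N1 + mat_inv R * \<Lambda>11 * P1 * mat_adjoint \<Lambda>11
     in invertible_mat R \<and> pos_det A \<and> pos_det B \<and> log2_det A = log2_det B"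
    \<comment> \<open>Rewriting with \<open>B\<close> and \<open>invD\<close> turns the second
      matrix literally into the first, so \<open>pos\<close> serves both and the logarithms agree by
      reflexivity.\<close>
    unfolding Let_def v_def[symmetric] R_def[symmetric] D_def[symmetric] B invD
    using invR pos by blast
qed

end
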